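(* Let $C$ be a finite set of $m$ colours and let $\mathcal{E}$ be a $\equiv_2$-class of finite $C$-coloured linear orders, with coloured orders counted up to isomorphism. Let $T$ and $g$ be the coloured $T$-configuration and interval-colour function common to the members of $\mathcal{E}$ (so that $\mathcal{E}=\mathcal{C}_{T,g}$). Then $\mathcal{E}$ is finite if and only if it is a singleton, and this holds if and only if $g(u,v)=\emptyset$ for every pair $u<v$ of consecutive members of $T$.
   Context: A $C$-coloured linear order is a triple $(A,<,F)$ where $(A,<)$ is a linear order and $F$ is a map from $A$ onto the set $C$ of colours; here $m=|C|\ge 1$. In the $n$-move Ehrenfeucht-Fraïssé game on coloured linear orders $A$ and $B$, players I and II move alternately, I first; on each move I picks an element of either structure and II responds with an element of the other structure. After $n$ moves elements $a_1,\dots,a_n\in A$ and $b_1,\dots,b_n\in B$ have been chosen, and II wins if $a_i\mapsto b_i$ is an order- and colour-isomorphism. $A\equiv_n B$ means that II has a winning strategy. A $T$-configuration is a linear order $T=\{x_i:1\le i\le m\}\cup\{y_i:1\le i\le m\}$, considered together with the labelling of its points, in which $x_1<x_2<\dots<x_m$, $y_1>y_2>\dots>y_m$, and $x_1$ and $y_1$ are the least and greatest members of $T$ respectively (it is allowed that $x_i=y_j$ for some $i,j$). A coloured $T$-configuration is a $T$-configuration together with an assignment of a colour from $C$ to each of its points. (Coloured) $T$-configurations are identified when there is an isomorphism preserving labels (and colours). If $(A,<,F)$ is a finite $C$-coloured linear order, its associated coloured $T$-configuration is the coloured linear order induced from $A$ on $\{x_i:1\le i\le m\}\cup\{y_i:1\le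 i\le m\}$, where $x_i$ is the least point $x$ of $A$ such that $\{F(z):z\in A, z\le x\}$ has $i$ elements, and $y_i$ is the greatest point $y$ of $A$ such that $\{F(z):z\in A,z\ge y\}$ has $i$ elements. For a coloured $T$-configuration $T$ and a function $g$ assigning to each pair $u<v$ of consecutive members of $T$ a set of colours $g(u,v)$, $\mathcal{C}_{T,g}$ denotes the set of all finite $C$-coloured linear orders $A$ whose associated coloured $T$-configuration is $T$ and such that, for all consecutive members $u<v$ of $T$, the set of colours of the points of $A$ lying strictly between $u$ and $v$ is $g(u,v)$. The $\equiv_2$-classes of finite $C$-coloured linear orders are exactly the non-empty sets of the form $\mathcal{C}_{T,g}$. *)

theory Defs
  imports "HOL-Library.Infinite_Typeclass"
begin

section \<open>Finite coloured linear orders\<close>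

text \<open>\<open>lt\<close> is the strict order. The colour function is total on the type; only its values on
  the carrier matter.\<close>

record ('a, 'c) clo =
  carrier :: "'a set"
  lt :: "('a \<times> 'a) set"
  col :: "'a \<Rightarrow> 'c"

definition le :: "('a, 'c, 'z) clo_scheme \<Rightarrow> 'a \<Rightarrow> 'a \<Rightarrow> bool" where
  "le A x y \<longleftrightarrow> x = y \<or> (x, y) \<in> lt A"

definition linear_order_struct :: "('a, 'c, 'z) clo_scheme \<Rightarrow> bool" where
  "linear_order_struct A \<longleftrightarrow>
     lt A \<subseteq> carrier A \<times> carrier A \<and> strict_linear_order_on (carrier A) (lt A)"

definition finite_clos :: "'c set \<Rightarrow> ('a, 'c) clo set" where
  "finite_clos C =
     {A. finite (carrier A) \<and> linear_order_struct A \<and> col A ` carrier A = C}"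

definition clo_iso ::
  "('a \<Rightarrow> 'b) \<Rightarrow> ('a, 'c, 'y) clo_scheme \<Rightarrow> ('b, 'c, 'z) clo_scheme \<Rightarrow> bool" where
  "clo_iso f A B \<longleftrightarrow>
     bij_betw f (carrier A) (carrier B) \<and>
     (\<forall>x\<in>carrier A. \<forall>y\<in>carrier A. (x, y) \<in> lt A \<longleftrightarrow> (f x, f y) \<in> lt B) \<and>
     (\<forall>x\<in>carrier A. col B (f x) = col A x)"

definition iso_rel :: "'c set \<Rightarrow> (('a, 'c) clo \<times> ('a, 'c) clo) set" where
  "iso_rel C = {(A, B). A \<in> finite_clos C \<and> B \<in> finite_clos C \<and> (\<exists>f. clo_iso f A B)}"


section \<open>Ehrenfeucht-Fraisse games\<close>

text \<open>A move of player I is \<open>Inl a\<close> (the element \<open>a\<close> of the first structure) or \<open>Inr b\<close> (the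
  element \<open>b\<close> of the second one). A strategy of player II consists of two functions, giving the
  response to a move in the first and in the second structure respectively. Their arguments are
  the list of the earlier moves of player I and the element just picked; the earlier responses of
  player II need not be recorded, being determined by the strategy.\<close>

type_synonym ('a, 'b) strategy =
  "(('a + 'b) list \<Rightarrow> 'a \<Rightarrow> 'b) \<times> (('a + 'b) list \<Rightarrow> 'b \<Rightarrow> 'a)"

fun game_round :: "('a, 'b) strategy \<Rightarrow> ('a + 'b) list \<Rightarrow> 'a + 'b \<Rightarrow> 'a \<times> 'b" where
  "game_round s ms (Inl a) = (a, fst s ms a)"
| "game_round s ms (Inr b) = (snd s ms b, b)"

definition play :: "('a, 'b) strategy \<Rightarrow> ('a + 'b) list \<Rightarrow> ('a \<times> 'b) list" where
  "play s ms = map (\<lambda>i. game_round s (take i ms) (ms ! i)) [0..<length ms]"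

definition partial_iso :: "('a, 'c) clo \<Rightarrow> ('b, 'c) clo \<Rightarrow> ('a \<times> 'b) set \<Rightarrow> bool" where
  "partial_iso A B R \<longleftrightarrow>
     (\<forall>(a, b)\<in>R. col A a = col B b) \<and>
     (\<forall>(a, b)\<in>R. \<forall>(a', b')\<in>R.
        (a = a' \<longleftrightarrow> b = b') \<and> ((a, a') \<in> lt A \<longleftrightarrow> (b, b') \<in> lt B))"

definition winning_strategy ::
  "nat \<Rightarrow> ('a, 'c) clo \<Rightarrow> ('b, 'c) clo \<Rightarrow> ('a, 'b) strategy \<Rightarrow> bool" where
  "winning_strategy n A B s \<longleftrightarrow>
     (\<forall>ms. length ms = n \<and> set ms \<subseteq> carrier A <+> carrier B \<longrightarrow>
        set (play s ms) \<subseteq> carrier A \<times> carrier B \<and> partial_iso A B (set (play s ms)))"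

definition EF_equiv :: "nat \<Rightarrow> ('a, 'c) clo \<Rightarrow> ('b, 'c) clo \<Rightarrow> bool" where
  "EF_equiv n A B \<longleftrightarrow> (\<exists>s. winning_strategy n A B s)"

definition EF_rel :: "nat \<Rightarrow> 'c set \<Rightarrow> (('a, 'c) clo \<times> ('a, 'c) clo) set" where
  "EF_rel n C = {(A, B). A \<in> finite_clos C \<and> B \<in> finite_clos C \<and> EF_equiv n A B}"

definition EF_classes :: "nat \<Rightarrow> 'c set \<Rightarrow> ('a, 'c) clo set set" where
  "EF_classes n C = finite_clos C // EF_rel n C"


section \<open>Coloured T-configurations\<close>

text \<open>The labels are \<open>xl T i\<close> and \<open>yl T i\<close> for \<open>1 \<le> i \<le> card C\<close>; other values are
  irrelevant.\<close>

record ('a, 'c) tconf = "('a, 'c) clo" +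
  xl :: "nat \<Rightarrow> 'a"
  yl :: "nat \<Rightarrow> 'a"

definition coloured_tconf :: "'c set \<Rightarrow> ('a, 'c) tconf \<Rightarrow> bool" where
  "coloured_tconf C T \<longleftrightarrow>
     linear_order_struct T \<and>
     carrier T = xl T ` {1..card C} \<union> yl T ` {1..card C} \<and>
     (\<forall>i\<in>{1..card C}. \<forall>j\<in>{1..card C}. i < j \<longrightarrow>
        (xl T i, xl T j) \<in> lt T \<and> (yl T j, yl T i) \<in> lt T) \<and>
     (\<forall>t\<in>carrier T. le T (xl T 1) t \<and> le T t (yl T 1)) \<and>
     col T ` carrier T \<subseteq> C"

definition tconf_iso ::
  "'c set \<Rightarrow> ('a \<Rightarrow> 'b) \<Rightarrow> ('a, 'c) tconf \<Rightarrow> ('b, 'c) tconf \<Rightarrow> bool" where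
  "tconf_iso C f S T \<longleftrightarrow>
     clo_iso f S T \<and> (\<forall>i\<in>{1..card C}. f (xl S i) = xl T i \<and> f (yl S i) = yl T i)"

definition least_pt :: "('a, 'c) clo \<Rightarrow> 'a set \<Rightarrow> 'a" where
  "least_pt A S = (THE x. x \<in> S \<and> (\<forall>z\<in>S. le A x z))"

definition greatest_pt :: "('a, 'c) clo \<Rightarrow> 'a set \<Rightarrow> 'a" where
  "greatest_pt A S = (THE y. y \<in> S \<and> (\<forall>z\<in>S. le A z y))"

definition x_pt :: "('a, 'c) clo \<Rightarrow> nat \<Rightarrow> 'a" where
  "x_pt A i = least_pt A {x \<in> carrier A. card (col A ` {z \<in> carrier A. le A z x}) = i}"

definition y_pt :: "('a, 'c) clo \<Rightarrow> nat \<Rightarrow> 'a" where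
  "y_pt A i = greatest_pt A {y \<in> carrier A. card (col A ` {z \<in> carrier A. le A y z}) = i}"

definition assoc_tconf :: "'c set \<Rightarrow> ('a, 'c) clo \<Rightarrow> ('a, 'c) tconf" where
  "assoc_tconf C A =
     (let P = x_pt A ` {1..card C} \<union> y_pt A ` {1..card C}
      in \<lparr>carrier = P, lt = lt A \<inter> (P \<times> P), col = col A, xl = x_pt A, yl = y_pt A\<rparr>)"

definition consecutive :: "('a, 'c) tconf \<Rightarrow> 'a \<Rightarrow> 'a \<Rightarrow> bool" where
  "consecutive T u v \<longleftrightarrow>
     u \<in> carrier T \<and> v \<in> carrier T \<and> (u, v) \<in> lt T \<and>
     (\<nexists>w. w \<in> carrier T \<and> (u, w) \<in> lt T \<and> (w, v) \<in> lt T)"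

definition colours_between :: "('a, 'c) clo \<Rightarrow> 'a \<Rightarrow> 'a \<Rightarrow> 'c set" where
  "colours_between A u v = col A ` {z \<in> carrier A. (u, z) \<in> lt A \<and> (z, v) \<in> lt A}"

text \<open>Configurations are identified up to isomorphism, so "the associated configuration of \<open>A\<close>
  is \<open>T\<close>" is witnessed by a map \<open>f\<close> from \<open>T\<close> into \<open>A\<close>. Since all points of \<open>T\<close> are labelled,
  \<open>f\<close> is unique on \<open>T\<close>.\<close>

definition C_Tg ::
  "'c set \<Rightarrow> ('b, 'c) tconf \<Rightarrow> ('b \<Rightarrow> 'b \<Rightarrow> 'c set) \<Rightarrow> ('a, 'c) clo set" where
  "C_Tg C T g =
     {A \<in> finite_clos C. \<exists>f. tconf_iso C f T (assoc_tconf C A) \<and>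
        (\<forall>u v. consecutive T u v \<longrightarrow> colours_between A (f u) (f v) = g u v)}"

end

theory Submission
  imports Defs
begin

text \<open>A point of a coloured order that is neither the first nor the last one of its colour can be
  duplicated without leaving the \<open>\<equiv>\<^sub>2\<close>-class. Indeed the 2-move game sees of a point only its
  colour, the set of colours below it and the set of colours above it (\<open>EF_equiv_2I\<close>); the copy
  repeats a colour that is already present on both sides, so no point changes its data and the copy
  has those of the original (\<open>duplicate_inner_point\<close>). Repeating this gives members of the class of
  every sufficiently large size, hence infinitely many isomorphism types.

  The points of the associated configuration are precisely the first and last occurrences of the
  colours. Thus a member \<open>A\<close> of the class has a point that can be duplicated unless the
  configuration exhausts \<open>A\<close>, and since the least and the greatest point of \<open>A\<close> belong to the
  configuration, every other point lies between two consecutive members of it. So \<open>A\<close> is exhausted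
  iff all the sets \<open>g u v\<close> are empty (\<open>carrier_eq_config_iff\<close>). In that case every member of the
  class is isomorphic to the underlying order of \<open>T\<close>, and there is just one up to isomorphism.\<close>


section \<open>Isomorphism of coloured orders\<close>

lemma linear_order_structD:
  assumes "linear_order_struct A"
  shows "(x, y) \<in> lt A \<Longrightarrow> x \<in> carrier A \<and> y \<in> carrier A"
    and "(x, y) \<in> lt A \<Longrightarrow> (y, z) \<in> lt A \<Longrightarrow> (x, z) \<in> lt A"
    and "(x, x) \<notin> lt A"
    and "x \<in> carrier A \<Longrightarrow> y \<in> carrier A \<Longrightarrow> x \<noteq> y \<Longrightarrow> (x, y) \<in> lt A \<or> (y, x) \<in> lt A"
  using assms unfolding linear_order_struct_def strict_linear_order_on_def
  by (auto simp: irrefl_def total_on_def dest: transD)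

lemma clo_iso_id: "clo_iso id A A"
  by (simp add: clo_iso_def)

lemma clo_iso_inv_into:
  assumes "clo_iso f A B"
  shows "clo_iso (inv_into (carrier A) f) B A"
proof -
  let ?h = "inv_into (carrier A) f"
  have bij: "bij_betw f (carrier A) (carrier B)"
    using assms by (simp add: clo_iso_def)
  have h: "?h y \<in> carrier A \<and> f (?h y) = y" if "y \<in> carrier B" for y
    using bij that by (metis bij_betw_imp_surj_on f_inv_into_f inv_into_into)
  show ?thesis
    using assms h bij_betw_inv_into[OF bij] unfolding clo_iso_def by metis
qed

lemma clo_iso_comp:
  assumes f: "clo_iso f A B" and h: "clo_iso h B D"
  shows "clo_iso (h \<circ> f) A D"
proof -
  have "f x \<in> carrier B" if "x \<in> carrier A" for x
    using f that by (auto simp: clo_iso_def bij_betw_def)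
  then show ?thesis
    using f h unfolding clo_iso_def by (auto intro: bij_betw_trans)
qed

lemma equiv_iso_rel: "equiv (finite_clos C) (iso_rel C)"
proof (rule equivI)
  show "iso_rel C \<subseteq> finite_clos C \<times> finite_clos C"
    by (auto simp: iso_rel_def)
  show "refl_on (finite_clos C) (iso_rel C)"
    by (auto simp: refl_on_def iso_rel_def intro: clo_iso_id)
  show "sym (iso_rel C)"
    by (auto simp: sym_def iso_rel_def intro: clo_iso_inv_into)
  show "trans (iso_rel C)"
    by (rule transI) (auto simp: iso_rel_def intro: clo_iso_comp)
qed


section \<open>A sufficient condition for \<open>\<equiv>\<^sub>2\<close>\<close>

definition point_type :: "('a, 'c) clo \<Rightarrow> 'a \<Rightarrow> 'c \<times> 'c set \<times> 'c set" where
  "point_type A a = (col A a, col A ` {z. (z, a) \<in> lt A}, col A ` {z. (a, z) \<in> lt A})"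

lemma partial_iso_converse: "partial_iso A B R \<Longrightarrow> partial_iso B A (R\<inverse>)"
  unfolding partial_iso_def Ball_def split_paired_All prod.case converse_iff
  by (intro conjI allI impI) simp_all

text \<open>With one move left, a move on either side of \<open>a\<^sub>0\<close> is answered by a point of the same colour on
  the same side of \<open>b\<^sub>0\<close>.\<close>

lemma point_type_extend:
  assumes A: "linear_order_struct A" and B: "linear_order_struct B"
    and a0: "a\<^sub>0 \<in> carrier A" and b0: "b\<^sub>0 \<in> carrier B"
    and eq: "point_type A a\<^sub>0 = point_type B b\<^sub>0" and a: "a \<in> carrier A"
  shows "\<exists>b\<in>carrier B. partial_iso A B {(a\<^sub>0, b\<^sub>0), (a, b)}"
proof -
  note A' = linear_order_structD[OF A] and B' = linear_order_structD[OF B]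
  have c0: "col A a\<^sub>0 = col B b\<^sub>0"
    and below: "col A ` {z. (z, a\<^sub>0) \<in> lt A} = col B ` {z. (z, b\<^sub>0) \<in> lt B}"
    and above: "col A ` {z. (a\<^sub>0, z) \<in> lt A} = col B ` {z. (b\<^sub>0, z) \<in> lt B}"
    using eq by (auto simp: point_type_def)
  consider "a = a\<^sub>0" | "(a, a\<^sub>0) \<in> lt A" | "(a\<^sub>0, a) \<in> lt A"
    using A'(4) a a0 by blast
  then show ?thesis
  proof cases
    case 1
    then show ?thesis
      using c0 b0 A'(3) B'(3) by (auto simp: partial_iso_def)
  next
    case 2
    then have "col A a \<in> col B ` {z. (z, b\<^sub>0) \<in> lt B}"
      using below by blast
    then obtain b where b: "(b, b\<^sub>0) \<in> lt B" "col A a = col B b"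
      by auto
    have "(a\<^sub>0, a) \<notin> lt A" "(b\<^sub>0, b) \<notin> lt B"
      using 2 b(1) A'(2,3) B'(2,3) by blast+
    then have "partial_iso A B {(a\<^sub>0, b\<^sub>0), (a, b)}"
      using 2 b c0 A'(3) B'(3) by (auto simp: partial_iso_def)
    then show ?thesis
      using b(1) B'(1) by blast
  next
    case 3
    then have "col A a \<in> col B ` {z. (b\<^sub>0, z) \<in> lt B}"
      using above by blast
    then obtain b where b: "(b\<^sub>0, b) \<in> lt B" "col A a = col B b"
      by auto
    have "(a, a\<^sub>0) \<notin> lt A" "(b, b\<^sub>0) \<notin> lt B"
      using 3 b(1) A'(2,3) B'(2,3) by blast+
    then have "partial_iso A B {(a\<^sub>0, b\<^sub>0), (a, b)}"
      using 3 b c0 A'(3) B'(3) by (auto simp: partial_iso_def)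
    then show ?thesis
      using b(1) B'(1) by blast
  qed
qed

text \<open>Player II first answers with a point of the same type, which keeps the second move
  answerable.\<close>

lemma EF_equiv_2I:
  fixes A :: "('a, 'c) clo" and B :: "('b, 'c) clo"
  assumes A: "linear_order_struct A" and B: "linear_order_struct B"
    and types: "point_type A ` carrier A = point_type B ` carrier B"
  shows "EF_equiv 2 A B"
proof -
  define open1 where "open1 a = (SOME b. b \<in> carrier B \<and> point_type A a = point_type B b)" for a
  define open2 where "open2 b = (SOME a. a \<in> carrier A \<and> point_type A a = point_type B b)" for b
  define first where "first m = (case m of Inl a \<Rightarrow> (a, open1 a) | Inr b \<Rightarrow> (open2 b, b))" for m
  define reply1 where
    "reply1 p a = (SOME b. b \<in> carrier B \<and> partial_iso A B {p, (a, b)})" for p a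
  define reply2 where
    "reply2 p b = (SOME a. a \<in> carrier A \<and> partial_iso A B {p, (a, b)})" for p b
  define s where
    "s = (\<lambda>ms a. if ms = [] then open1 a else reply1 (first (hd ms)) a,
          \<lambda>ms b. if ms = [] then open2 b else reply2 (first (hd ms)) b)"
  have open1: "open1 a \<in> carrier B \<and> point_type A a = point_type B (open1 a)"
    if "a \<in> carrier A" for a
    unfolding open1_def by (rule someI_ex) (use types that in blast)
  have open2: "open2 b \<in> carrier A \<and> point_type A (open2 b) = point_type B b"
    if "b \<in> carrier B" for b
    unfolding open2_def by (rule someI_ex) (use types that in force)
  have "winning_strategy 2 A B s"
    unfolding winning_strategy_def
  proof (intro allI impI)
    fix ms :: "('a + 'b) list"
    assume ms: "length ms = 2 \<and> set ms \<subseteq> carrier A <+> carrier B"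
    then obtain k l where kl: "ms = [k, l]"
      by (auto simp: numeral_2_eq_2 length_Suc_conv)
    have k: "k \<in> carrier A <+> carrier B" and l: "l \<in> carrier A <+> carrier B"
      using ms kl by auto
    obtain a\<^sub>0 b\<^sub>0 where ab: "first k = (a\<^sub>0, b\<^sub>0)"
      by fastforce
    have "a\<^sub>0 \<in> carrier A \<and> b\<^sub>0 \<in> carrier B \<and> point_type A a\<^sub>0 = point_type B b\<^sub>0"
    proof (cases k)
      case (Inl a)
      then show ?thesis
        using ab k open1 by (auto simp: first_def)
    next
      case (Inr b)
      then show ?thesis
        using ab k open2 by (auto simp: first_def)
    qed
    then have ab0: "a\<^sub>0 \<in> carrier A" "b\<^sub>0 \<in> carrier B" "point_type A a\<^sub>0 = point_type B b\<^sub>0"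
      by blast+
    have "game_round s [] k = (a\<^sub>0, b\<^sub>0)"
      using ab by (cases k) (auto simp: s_def first_def)
    then have play: "set (play s ms) = {(a\<^sub>0, b\<^sub>0), game_round s [k] l}"
      by (simp add: play_def kl upt_rec)
    have "game_round s [k] l \<in> carrier A \<times> carrier B \<and>
        partial_iso A B {(a\<^sub>0, b\<^sub>0), game_round s [k] l}"
    proof (cases l)
      case (Inl a)
      then have a: "a \<in> carrier A"
        using l by auto
      have "reply1 (a\<^sub>0, b\<^sub>0) a \<in> carrier B \<and>
          partial_iso A B {(a\<^sub>0, b\<^sub>0), (a, reply1 (a\<^sub>0, b\<^sub>0) a)}"
        unfolding reply1_def
        by (rule someI_ex) (use point_type_extend[OF A B ab0 a] in blast)
      then show ?thesis
        using Inl a ab by (simp add: s_def)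
    next
      case (Inr b)
      then have b: "b \<in> carrier B"
        using l by auto
      obtain a where "a \<in> carrier A" "partial_iso B A {(b\<^sub>0, a\<^sub>0), (b, a)}"
        using point_type_extend[OF B A ab0(2,1) ab0(3)[symmetric] b] by blast
      moreover have "{(b\<^sub>0, a\<^sub>0), (b, a)}\<inverse> = {(a\<^sub>0, b\<^sub>0), (a, b)}"
        by auto
      ultimately have "\<exists>a. a \<in> carrier A \<and> partial_iso A B {(a\<^sub>0, b\<^sub>0), (a, b)}"
        using partial_iso_converse by metis
      then have "reply2 (a\<^sub>0, b\<^sub>0) b \<in> carrier A \<and>
          partial_iso A B {(a\<^sub>0, b\<^sub>0), (reply2 (a\<^sub>0, b\<^sub>0) b, b)}"
        unfolding reply2_def by (rule someI_ex)
      then show ?thesis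
        using Inr b ab by (simp add: s_def)
    qed
    then show "set (play s ms) \<subseteq> carrier A \<times> carrier B \<and> partial_iso A B (set (play s ms))"
      using play ab0 by simp
  qed
  then show ?thesis
    unfolding EF_equiv_def by blast
qed


section \<open>Duplicating a point\<close>

text \<open>The copy \<open>p\<close> becomes the immediate successor of \<open>z\<close>.\<close>

definition duplicate_point :: "('a, 'c) clo \<Rightarrow> 'a \<Rightarrow> 'a \<Rightarrow> ('a, 'c) clo" where
  "duplicate_point A z p =
     \<lparr>carrier = insert p (carrier A),
      lt = lt A \<union> {w. le A w z} \<times> {p} \<union> {p} \<times> {w. (z, w) \<in> lt A},
      col = (col A)(p := col A z)\<rparr>"

lemma linear_order_struct_duplicate_point:
  assumes A: "linear_order_struct A" and z: "z \<in> carrier A" and p: "p \<notin> carrier A"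
  shows "linear_order_struct (duplicate_point A z p)"
proof -
  note A' = linear_order_structD[OF A]
  have no_p: "(p, w) \<notin> lt A" "(w, p) \<notin> lt A" for w
    using A'(1) p by blast+
  have "p \<noteq> z"
    using z p by blast
  have lt_iff: "(x, y) \<in> lt (duplicate_point A z p) \<longleftrightarrow>
      (x, y) \<in> lt A \<or> y = p \<and> (x = z \<or> (x, z) \<in> lt A) \<or> x = p \<and> (z, y) \<in> lt A" for x y
    by (auto simp: duplicate_point_def le_def)
  have carrier: "carrier (duplicate_point A z p) = insert p (carrier A)"
    by (simp add: duplicate_point_def)
  have comparable: "(x, p) \<in> lt (duplicate_point A z p) \<or> (p, x) \<in> lt (duplicate_point A z p)"
    if "x \<in> carrier A" for x
    unfolding lt_iff using A'(4)[OF that z] by blast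
  have "trans (lt (duplicate_point A z p))"
  proof (rule transI)
    fix x y w
    assume xy: "(x, y) \<in> lt (duplicate_point A z p)"
      and yw: "(y, w) \<in> lt (duplicate_point A z p)"
    from xy consider "(x, y) \<in> lt A" | "y = p" "x = z \<or> (x, z) \<in> lt A" | "x = p" "(z, y) \<in> lt A"
      unfolding lt_iff by blast
    then show "(x, w) \<in> lt (duplicate_point A z p)"
    proof cases
      case 1
      then have "(y, w) \<in> lt A \<or> w = p \<and> (y = z \<or> (y, z) \<in> lt A)"
        using yw no_p unfolding lt_iff by blast
      then show ?thesis
        unfolding lt_iff using 1 A'(2)[OF 1] by blast
    next
      case 2
      then have "(z, w) \<in> lt A"
        using yw no_p \<open>p \<noteq> z\<close> unfolding lt_iff by blast
      then show ?thesis
        unfolding lt_iff using 2 A'(2)[of x z w] by blast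
    next
      case 3
      then have "(y, w) \<in> lt A"
        using yw no_p A'(3)[of z] A'(2)[of z y z] unfolding lt_iff by blast
      then show ?thesis
        unfolding lt_iff using 3 A'(2)[of z y w] by blast
    qed
  qed
  moreover have "irrefl (lt (duplicate_point A z p))"
    using no_p \<open>p \<noteq> z\<close> by (simp add: irrefl_def lt_iff A'(3))
  moreover have "total_on (carrier (duplicate_point A z p)) (lt (duplicate_point A z p))"
    unfolding total_on_def carrier using comparable A'(4) lt_iff by (metis insert_iff)
  moreover have "lt (duplicate_point A z p) \<subseteq>
      carrier (duplicate_point A z p) \<times> carrier (duplicate_point A z p)"
    unfolding carrier using A'(1) z lt_iff by fastforce
  ultimately show ?thesis
    by (simp add: linear_order_struct_def strict_linear_order_on_def)
qed

text \<open>The copy is absorbed: whenever it is added to the points below (above) \<open>x\<close>, the point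
  \<open>z\<^sub>1\<close> (respectively \<open>z\<^sub>2\<close>) of the same colour is there already.\<close>

lemma point_type_duplicate_point:
  assumes A: "linear_order_struct A" and p: "p \<notin> carrier A"
    and z1: "(z\<^sub>1, z) \<in> lt A" "col A z\<^sub>1 = col A z"
    and z2: "(z, z\<^sub>2) \<in> lt A" "col A z\<^sub>2 = col A z"
  shows "x \<in> carrier A \<Longrightarrow> point_type (duplicate_point A z p) x = point_type A x"
    and "point_type (duplicate_point A z p) p = point_type A z"
proof -
  note A' = linear_order_structD[OF A]
  let ?B = "duplicate_point A z p"
  have no_p: "(p, w) \<notin> lt A" "(w, p) \<notin> lt A" for w
    using A'(1) p by blast+
  have z: "z \<in> carrier A" "z \<noteq> p"
    using A'(1) z1 p by blast+
  have old: "(col A)(p := c) ` {w. (w, x) \<in> lt A} = col A ` {w. (w, x) \<in> lt A}"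
    "(col A)(p := c) ` {w. (x, w) \<in> lt A} = col A ` {w. (x, w) \<in> lt A}" for x c
    using no_p by (auto intro!: image_cong)
  show "point_type ?B x = point_type A x" if x: "x \<in> carrier A"
  proof -
    have "x \<noteq> p"
      using x p by blast
    have below: "{w. (w, x) \<in> lt ?B} = {w. (w, x) \<in> lt A} \<union> (if (z, x) \<in> lt A then {p} else {})"
      and above: "{w. (x, w) \<in> lt ?B} = {w. (x, w) \<in> lt A} \<union> (if le A x z then {p} else {})"
      using \<open>x \<noteq> p\<close> by (auto simp: duplicate_point_def)
    have colB: "col ?B = (col A)(p := col A z)"
      by (simp add: duplicate_point_def)
    have "col ?B ` {w. (w, x) \<in> lt ?B} = col A ` {w. (w, x) \<in> lt A}"
      unfolding below colB image_Un old by auto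
    moreover have "col A z \<in> col A ` {w. (x, w) \<in> lt A}" if "le A x z"
    proof -
      have "(x, z\<^sub>2) \<in> lt A"
        using that z2(1) A'(2) by (auto simp: le_def)
      then show ?thesis
        using z2(2) by (metis (mono_tags) image_eqI mem_Collect_eq)
    qed
    then have "col ?B ` {w. (x, w) \<in> lt ?B} = col A ` {w. (x, w) \<in> lt A}"
      unfolding above colB image_Un old by auto
    ultimately show ?thesis
      using \<open>x \<noteq> p\<close> by (simp add: point_type_def colB)
  qed
  have "{w. (w, p) \<in> lt ?B} = insert z {w. (w, z) \<in> lt A}"
    and "{w. (p, w) \<in> lt ?B} = {w. (z, w) \<in> lt A}"
    using no_p z by (auto simp: duplicate_point_def le_def)
  moreover have "col A z \<in> col A ` {w. (w, z) \<in> lt A}"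
    using z1 by (metis (mono_tags) image_eqI mem_Collect_eq)
  ultimately show "point_type ?B p = point_type A z"
    using z old by (auto simp: point_type_def duplicate_point_def)
qed

text \<open>The possibility of duplicating some point is itself visible in the set of point types, which
  lets the construction be iterated.\<close>

lemma duplicate_inner_point:
  fixes A :: "('a::infinite, 'c) clo"
  assumes A: "A \<in> finite_clos C"
    and inner: "(c, L, U) \<in> point_type A ` carrier A" "c \<in> L" "c \<in> U"
  shows "\<exists>B\<in>finite_clos C :: ('a, 'c) clo set. card (carrier B) = Suc (card (carrier A)) \<and>
           point_type B ` carrier B = point_type A ` carrier A"
proof -
  have lin: "linear_order_struct A" and fin: "finite (carrier A)"
    and colours: "col A ` carrier A = C"
    using A by (auto simp: finite_clos_def)
  obtain z where z: "z \<in> carrier A" "(c, L, U) = point_type A z"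
    using inner(1) by blast
  obtain z\<^sub>1 z\<^sub>2 where z1: "(z\<^sub>1, z) \<in> lt A" "col A z\<^sub>1 = col A z"
    and z2: "(z, z\<^sub>2) \<in> lt A" "col A z\<^sub>2 = col A z"
    using z(2) inner(2,3) by (auto simp: point_type_def)
  obtain p where p: "p \<notin> carrier A"
    using ex_new_if_finite[OF infinite_UNIV fin] by blast
  let ?B = "duplicate_point A z p"
  have carrier: "carrier ?B = insert p (carrier A)"
    by (simp add: duplicate_point_def)
  have "col ?B ` carrier ?B = C"
    using colours z(1) p by (auto simp: duplicate_point_def)
  then have "?B \<in> finite_clos C"
    using linear_order_struct_duplicate_point[OF lin z(1) p] fin
    by (simp add: finite_clos_def carrier)
  moreover have "point_type ?B ` carrier ?B = point_type A ` carrier A"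
    using point_type_duplicate_point[OF lin p z1 z2] z(1) by (auto simp: carrier)
  moreover have "card (carrier ?B) = Suc (card (carrier A))"
    using fin p by (simp add: carrier)
  ultimately show ?thesis
    by blast
qed

lemma same_types_of_any_larger_size:
  fixes A :: "('a::infinite, 'c) clo"
  assumes A: "A \<in> finite_clos C"
    and inner: "(c, L, U) \<in> point_type A ` carrier A" "c \<in> L" "c \<in> U"
  shows "\<exists>B\<in>finite_clos C :: ('a, 'c) clo set. card (carrier B) = card (carrier A) + n \<and>
           point_type B ` carrier B = point_type A ` carrier A"
proof (induction n)
  case 0
  show ?case
    using A by (auto intro!: rev_bexI[of A])
next
  case (Suc n)
  then obtain B :: "('a, 'c) clo" where B: "B \<in> finite_clos C" "card (carrier B) = card (carrier A) + n"
    "point_type B ` carrier B = point_type A ` carrier A"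
    by blast
  then show ?case
    using duplicate_inner_point[OF B(1), of c L U] inner by auto
qed

text \<open>Isomorphic orders have the same size, so distinct sizes give distinct isomorphism classes.\<close>

lemma infinite_iso_classes:
  assumes sub: "E \<subseteq> finite_clos C"
    and sizes: "\<And>n. \<exists>B\<in>E. card (carrier B) = k + n"
  shows "infinite (E // iso_rel C)"
proof
  assume fin: "finite (E // iso_rel C)"
  let ?size = "\<lambda>X. card (carrier (SOME A. A \<in> X))"
  have "k + n \<in> ?size ` (E // iso_rel C)" for n
  proof -
    obtain B where B: "B \<in> E" "card (carrier B) = k + n"
      using sizes by blast
    have "B \<in> iso_rel C `` {B}"
      using B(1) sub equiv_class_self[OF equiv_iso_rel] by blast
    then have "(SOME A. A \<in> iso_rel C `` {B}) \<in> iso_rel C `` {B}"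
      by (rule someI)
    then have "?size (iso_rel C `` {B}) = card (carrier B)"
      by (auto simp: iso_rel_def clo_iso_def dest: bij_betw_same_card)
    moreover have "iso_rel C `` {B} \<in> E // iso_rel C"
      using B(1) by (rule quotientI)
    ultimately show ?thesis
      by (intro rev_image_eqI[of "iso_rel C `` {B}"]) (simp_all add: B(2))
  qed
  then have "range ((+) k) \<subseteq> ?size ` (E // iso_rel C)"
    by blast
  then have "finite (range ((+) k))"
    using fin finite_subset by blast
  then show False
    using finite_imageD[of "(+) k" UNIV] by simp
qed


section \<open>Configuration points are first and last occurrences of colours\<close>

lemma finite_has_least:
  assumes A: "linear_order_struct A" and "finite S" "S \<noteq> {}" "S \<subseteq> carrier A"
  shows "\<exists>x\<in>S. \<forall>z\<in>S. le A x z"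
  using assms(2-4)
proof (induction rule: finite_ne_induct)
  case (singleton x)
  then show ?case
    by (simp add: le_def)
next
  case (insert y S)
  note A' = linear_order_structD[OF A]
  obtain x where x: "x \<in> S" "\<forall>z\<in>S. le A x z"
    using insert by auto
  have "x = y \<or> (x, y) \<in> lt A \<or> (y, x) \<in> lt A"
    using A'(4) x(1) insert.prems by blast
  then consider "le A x y" | "(y, x) \<in> lt A"
    by (auto simp: le_def)
  then show ?case
  proof cases
    case 1
    then show ?thesis
      using x by blast
  next
    case 2
    then have "\<forall>z\<in>insert y S. le A y z"
      using x A'(2) by (auto simp: le_def)
    then show ?thesis
      by blast
  qed
qed

text \<open>Reversing the order exchanges least and greatest, and so the points \<open>x\<^sub>i\<close> and \<open>y\<^sub>i\<close>.\<close>

definition dual :: "('a, 'c) clo \<Rightarrow> ('a, 'c) clo" where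
  "dual A = A\<lparr>lt := (lt A)\<inverse>\<rparr>"

lemma dual_simps [simp]:
  "carrier (dual A) = carrier A" "lt (dual A) = (lt A)\<inverse>" "col (dual A) = col A"
  "le (dual A) x y \<longleftrightarrow> le A y x"
  by (auto simp: dual_def le_def)

lemma dual_in_finite_clos: "A \<in> finite_clos C \<Longrightarrow> dual A \<in> finite_clos C"
  by (auto simp: finite_clos_def linear_order_struct_def strict_linear_order_on_def
      irrefl_def total_on_def trans_def)

lemma x_pt_dual: "x_pt (dual A) i = y_pt A i"
  by (simp add: x_pt_def y_pt_def least_pt_def greatest_pt_def)

definition first_occurrences :: "('a, 'c) clo \<Rightarrow> 'a set" where
  "first_occurrences A = {x \<in> carrier A. \<forall>w. (w, x) \<in> lt A \<longrightarrow> col A w \<noteq> col A x}"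

text \<open>A first occurrence strictly enlarges the set of colours seen so far, so it is the least point
  at which the number \<open>i\<close> of colours is reached.\<close>

lemma first_occurrence_is_x_pt:
  assumes A: "A \<in> finite_clos C" and x: "x \<in> first_occurrences A"
  shows "x \<in> x_pt A ` {1..card C}"
proof -
  have lin: "linear_order_struct A" and fin: "finite (carrier A)"
    and colours: "col A ` carrier A = C"
    using A by (auto simp: finite_clos_def)
  note A' = linear_order_structD[OF lin]
  let ?seen = "\<lambda>x. col A ` {z \<in> carrier A. le A z x}"
  let ?i = "card (?seen x)"
  let ?S = "{y \<in> carrier A. card (?seen y) = ?i}"
  have x': "x \<in> carrier A" "\<And>w. (w, x) \<in> lt A \<Longrightarrow> col A w \<noteq> col A x"
    using x by (auto simp: first_occurrences_def)
  have fin_seen: "finite (?seen y)" for y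
    using fin by auto
  have "col A x \<in> ?seen x"
    using x'(1) by (auto simp: le_def)
  then have "?i \<ge> 1"
    using fin_seen[of x] by (metis One_nat_def Suc_leI card_gt_0_iff empty_iff)
  moreover have "?i \<le> card C"
    using colours fin by (intro card_mono) auto
  moreover have least: "le A x y" if "y \<in> ?S" for y
  proof (rule ccontr)
    assume "\<not> le A x y"
    then have yx: "(y, x) \<in> lt A"
      using A'(4) x'(1) that by (auto simp: le_def)
    then have seen: "(z, x) \<in> lt A" if "le A z y" for z
      using that A'(2) by (auto simp: le_def)
    have "col A z \<noteq> col A x" if "le A z y" for z
      using x'(2) seen[OF that] by blast
    then have "col A x \<notin> ?seen y"
      by force
    moreover have "?seen y \<subseteq> ?seen x"
      using seen by (auto simp: le_def)
    ultimately have "?seen y \<subset> ?seen x"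
      using \<open>col A x \<in> ?seen x\<close> by blast
    then have "card (?seen y) < ?i"
      using fin_seen by (rule psubset_card_mono[rotated])
    then show False
      using that by simp
  qed
  moreover have "x_pt A ?i = x"
    unfolding x_pt_def least_pt_def
  proof (rule the_equality)
    show "x \<in> ?S \<and> (\<forall>z\<in>?S. le A x z)"
      using x'(1) least by blast
    show "y = x" if "y \<in> ?S \<and> (\<forall>z\<in>?S. le A y z)" for y
    proof -
      have "le A y x" "le A x y"
        using that x'(1) least by blast+
      then show ?thesis
        using A'(2,3) by (auto simp: le_def)
    qed
  qed
  ultimately show ?thesis
    by (intro image_eqI[of _ _ ?i]) simp_all
qed

lemma first_occurrence_exists:
  assumes A: "A \<in> finite_clos C" and "c \<in> C"
  shows "\<exists>x\<in>first_occurrences A. col A x = c"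
proof -
  have lin: "linear_order_struct A" and fin: "finite (carrier A)"
    and colours: "col A ` carrier A = C"
    using A by (auto simp: finite_clos_def)
  note A' = linear_order_structD[OF lin]
  let ?S = "{x \<in> carrier A. col A x = c}"
  have "finite ?S" "?S \<noteq> {}" "?S \<subseteq> carrier A"
    using fin colours \<open>c \<in> C\<close> by auto
  then obtain x where x: "x \<in> ?S" "\<forall>z\<in>?S. le A x z"
    using finite_has_least[OF lin] by meson
  have "col A w \<noteq> col A x" if wx: "(w, x) \<in> lt A" for w
  proof
    assume "col A w = col A x"
    then have "le A x w"
      using x A'(1)[OF wx] by auto
    then show False
      using wx A'(2,3) by (auto simp: le_def)
  qed
  then show ?thesis
    using x(1) by (auto simp: first_occurrences_def)
qed

text \<open>One inclusion suffices, by counting: there is a first occurrence of every colour, while there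
  are only \<open>card C\<close> indices.\<close>

lemma x_pts_eq_first_occurrences:
  assumes A: "A \<in> finite_clos C"
  shows "x_pt A ` {1..card C} = first_occurrences A"
proof -
  have sub: "first_occurrences A \<subseteq> x_pt A ` {1..card C}"
    using first_occurrence_is_x_pt[OF A] by blast
  have "C \<subseteq> col A ` first_occurrences A"
    using first_occurrence_exists[OF A] by blast
  moreover have fin: "finite (first_occurrences A)"
    using sub finite_subset by blast
  ultimately have "card C \<le> card (first_occurrences A)"
    by (rule surj_card_le[rotated])
  moreover have "card (x_pt A ` {1..card C}) \<le> card C"
    using card_image_le[of "{1..card C}"] by simp
  ultimately show ?thesis
    using sub by (metis card_seteq finite_atLeastAtMost finite_imageI le_trans)
qed

lemma y_pts_eq_last_occurrences:
  assumes "A \<in> finite_clos C"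
  shows "y_pt A ` {1..card C} = first_occurrences (dual A)"
  using x_pts_eq_first_occurrences[OF dual_in_finite_clos[OF assms]] by (simp add: x_pt_dual)

lemma carrier_assoc_tconf:
  assumes "A \<in> finite_clos C"
  shows "carrier (assoc_tconf C A) = first_occurrences A \<union> first_occurrences (dual A)"
  using x_pts_eq_first_occurrences[OF assms] y_pts_eq_last_occurrences[OF assms]
  by (simp add: assoc_tconf_def Let_def)

lemma assoc_tconf_simps:
  "lt (assoc_tconf C A) = lt A \<inter> carrier (assoc_tconf C A) \<times> carrier (assoc_tconf C A)"
  "col (assoc_tconf C A) = col A"
  by (simp_all add: assoc_tconf_def Let_def)

lemma inner_point_type:
  assumes A: "A \<in> finite_clos C" and z: "z \<in> carrier A" "z \<notin> carrier (assoc_tconf C A)"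
  shows "\<exists>c L U. (c, L, U) \<in> point_type A ` carrier A \<and> c \<in> L \<and> c \<in> U"
proof -
  have "\<exists>w. (w, z) \<in> lt A \<and> col A w = col A z" "\<exists>w. (z, w) \<in> lt A \<and> col A w = col A z"
    using z by (auto simp: carrier_assoc_tconf[OF A] first_occurrences_def)
  then have "col A z \<in> col A ` {w. (w, z) \<in> lt A}" "col A z \<in> col A ` {w. (z, w) \<in> lt A}"
    by (metis (mono_tags) image_eqI mem_Collect_eq)+
  moreover have "(col A z, col A ` {w. (w, z) \<in> lt A}, col A ` {w. (z, w) \<in> lt A})
      \<in> point_type A ` carrier A"
    using z(1) by (auto simp: point_type_def)
  ultimately show ?thesis
    by blast
qed

text \<open>The last configuration point below \<open>z\<close> exists because the first point of \<open>A\<close> is a first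
  occurrence; applied to the dual order, this also gives the next configuration point above \<open>z\<close>.\<close>

lemma last_config_point_below:
  assumes A: "A \<in> finite_clos C" and z: "z \<in> carrier A" "z \<notin> P"
    and P: "P = first_occurrences A \<union> first_occurrences (dual A)"
  shows "\<exists>u\<in>P. (u, z) \<in> lt A \<and> (\<forall>w\<in>P. (w, z) \<in> lt A \<longrightarrow> le A w u)"
proof -
  have lin: "linear_order_struct A" and fin: "finite (carrier A)"
    using A by (auto simp: finite_clos_def)
  note A' = linear_order_structD[OF lin]
  obtain x where x: "x \<in> carrier A" "\<forall>y\<in>carrier A. le A x y"
    using finite_has_least[OF lin fin] z(1) by blast
  have "(w, x) \<notin> lt A" for w
    using x A'(1,2,3) by (metis le_def)
  then have "x \<in> P"
    using x(1) P by (auto simp: first_occurrences_def)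
  then have "(x, z) \<in> lt A"
    using x z by (auto simp: le_def)
  let ?S = "{w \<in> P. (w, z) \<in> lt A}"
  have sub: "?S \<subseteq> carrier A"
    using A'(1) by blast
  then have "finite ?S" "?S \<noteq> {}"
    using fin finite_subset \<open>x \<in> P\<close> \<open>(x, z) \<in> lt A\<close> by blast+
  then have "\<exists>u\<in>?S. \<forall>w\<in>?S. le (dual A) u w"
    using dual_in_finite_clos[OF A] sub
    by (intro finite_has_least) (auto simp: finite_clos_def)
  then show ?thesis
    by auto
qed

lemma between_consecutive:
  assumes A: "A \<in> finite_clos C" and z: "z \<in> carrier A" "z \<notin> carrier (assoc_tconf C A)"
  shows "\<exists>u v. consecutive (assoc_tconf C A) u v \<and> (u, z) \<in> lt A \<and> (z, v) \<in> lt A"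
proof -
  let ?P = "carrier (assoc_tconf C A)"
  have lin: "linear_order_struct A"
    using A by (auto simp: finite_clos_def)
  note A' = linear_order_structD[OF lin]
  have P: "?P = first_occurrences A \<union> first_occurrences (dual A)"
    by (rule carrier_assoc_tconf[OF A])
  have dd: "dual (dual A) = A"
    by (simp add: dual_def)
  have P': "?P = first_occurrences (dual A) \<union> first_occurrences (dual (dual A))"
    unfolding dd P by (rule Un_commute)
  obtain u where u: "u \<in> ?P" "(u, z) \<in> lt A" "\<And>w. w \<in> ?P \<Longrightarrow> (w, z) \<in> lt A \<Longrightarrow> le A w u"
    using last_config_point_below[OF A z P] by blast
  obtain v where v: "v \<in> ?P" "(z, v) \<in> lt A" "\<And>w. w \<in> ?P \<Longrightarrow> (z, w) \<in> lt A \<Longrightarrow> le A v w"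
    using last_config_point_below[OF dual_in_finite_clos[OF A] _ z(2) P'] z(1) by auto
  have "\<not> ((u, w) \<in> lt A \<and> (w, v) \<in> lt A)" if w: "w \<in> ?P" for w
  proof
    assume uwv: "(u, w) \<in> lt A \<and> (w, v) \<in> lt A"
    have "w \<noteq> z"
      using w z(2) by blast
    then consider "(w, z) \<in> lt A" | "(z, w) \<in> lt A"
      using A'(1,4) uwv z(1) by blast
    then show False
    proof cases
      case 1
      then show False
        using u(3)[OF w] uwv A'(2,3) unfolding le_def by blast
    next
      case 2
      then show False
        using v(3)[OF w] uwv A'(2,3) unfolding le_def by blast
    qed
  qed
  then have "consecutive (assoc_tconf C A) u v"
    using u v A'(2)[OF u(2) v(2)] unfolding consecutive_def assoc_tconf_simps by blast
  then show ?thesis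
    using u v by blast
qed

text \<open>A point outside the configuration lies in the gap between two consecutive members of it, and a
  configuration point lies in no such gap. The map \<open>f\<close> transports the gaps of \<open>T\<close> to those of the
  configuration of \<open>A\<close>.\<close>

lemma carrier_eq_config_iff:
  assumes A: "A \<in> finite_clos C" and f: "tconf_iso C f T (assoc_tconf C A)"
    and g: "\<And>u v. consecutive T u v \<Longrightarrow> colours_between A (f u) (f v) = g u v"
  shows "carrier A = carrier (assoc_tconf C A) \<longleftrightarrow> (\<forall>u v. consecutive T u v \<longrightarrow> g u v = {})"
proof -
  let ?P = "carrier (assoc_tconf C A)"
  have bij: "f ` carrier T = ?P"
    and lt: "\<And>x y. x \<in> carrier T \<Longrightarrow> y \<in> carrier T \<Longrightarrow>
      (x, y) \<in> lt T \<longleftrightarrow> (f x, f y) \<in> lt (assoc_tconf C A)"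
    using f by (auto simp: tconf_iso_def clo_iso_def bij_betw_def)
  have ltA: "(x, y) \<in> lt T \<longleftrightarrow> (f x, f y) \<in> lt A" if "x \<in> carrier T" "y \<in> carrier T" for x y
    using lt[OF that] bij that by (auto simp: assoc_tconf_simps)
  show ?thesis
  proof (intro iffI allI impI)
    fix u v
    assume eq: "carrier A = ?P" and uv: "consecutive T u v"
    have "\<not> ((f u, z) \<in> lt A \<and> (z, f v) \<in> lt A)" if z: "z \<in> carrier A" for z
    proof -
      obtain w where w: "w \<in> carrier T" "z = f w"
        using z eq bij by blast
      then show ?thesis
        using uv ltA by (auto simp: consecutive_def)
    qed
    then have "colours_between A (f u) (f v) = {}"
      by (auto simp: colours_between_def)
    then show "g u v = {}"
      using g[OF uv] by simp
  next
    assume empty: "\<forall>u v. consecutive T u v \<longrightarrow> g u v = {}"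
    have "?P \<subseteq> carrier A"
      by (auto simp: carrier_assoc_tconf[OF A] first_occurrences_def)
    moreover have "z \<in> ?P" if z: "z \<in> carrier A" for z
    proof (rule ccontr)
      assume "z \<notin> ?P"
      then obtain u' v' where uv': "consecutive (assoc_tconf C A) u' v'"
        "(u', z) \<in> lt A" "(z, v') \<in> lt A"
        using between_consecutive[OF A z] by blast
      then have "u' \<in> f ` carrier T" "v' \<in> f ` carrier T"
        unfolding bij by (simp_all add: consecutive_def)
      then obtain u v where uv: "u \<in> carrier T" "u' = f u" "v \<in> carrier T" "v' = f v"
        by blast
      have "consecutive T u v"
        using uv' uv lt bij unfolding consecutive_def by blast
      moreover have "col A z \<in> colours_between A (f u) (f v)"
        using z uv' uv by (auto simp: colours_between_def)
      ultimately show False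
        using g empty by auto
    qed
    ultimately show "carrier A = ?P"
      by blast
  qed
qed


section \<open>Finite classes\<close>

theorem corollary2p3:
  fixes C :: "'c set" and m :: nat
    and E :: "('a::infinite, 'c) clo set"
    and T :: "('b, 'c) tconf" and g :: "'b \<Rightarrow> 'b \<Rightarrow> 'c set"
  assumes "finite C" and "card C = m" and "m \<ge> 1"
    and "E \<in> EF_classes 2 C"
    and "coloured_tconf C T"
    and "\<And>u v. consecutive T u v \<Longrightarrow> g u v \<subseteq> C"
    and "E \<subseteq> C_Tg C T g"
  shows "(finite (E // iso_rel C) \<longleftrightarrow> is_singleton (E // iso_rel C)) \<and>
         (is_singleton (E // iso_rel C) \<longleftrightarrow> (\<forall>u v. consecutive T u v \<longrightarrow> g u v = {}))"
proof -
  obtain A\<^sub>0 where A0: "A\<^sub>0 \<in> finite_clos C" and E: "E = EF_rel 2 C `` {A\<^sub>0}"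
    using assms(4) by (auto simp: EF_classes_def elim: quotientE)
  have sub: "E \<subseteq> finite_clos C"
    using E by (auto simp: EF_rel_def)
  have inE: "B \<in> E"
    if "B \<in> finite_clos C" "point_type B ` carrier B = point_type A\<^sub>0 ` carrier A\<^sub>0" for B
  proof -
    have "EF_equiv 2 A\<^sub>0 B"
      using that A0 by (intro EF_equiv_2I) (auto simp: finite_clos_def)
    then show ?thesis
      using that A0 E by (auto simp: EF_rel_def)
  qed
  then have "A\<^sub>0 \<in> E"
    using A0 by blast
  have T: "\<exists>f. tconf_iso C f T (assoc_tconf C A) \<and>
      (carrier A = carrier (assoc_tconf C A) \<longleftrightarrow> (\<forall>u v. consecutive T u v \<longrightarrow> g u v = {}))"
    if "A \<in> E" for A
  proof -
    have "A \<in> C_Tg C T g"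
      using that assms(7) by blast
    then obtain f where f: "tconf_iso C f T (assoc_tconf C A)"
      "\<forall>u v. consecutive T u v \<longrightarrow> colours_between A (f u) (f v) = g u v"
      unfolding C_Tg_def by blast
    show ?thesis
      using f(1) carrier_eq_config_iff[OF _ f(1) f(2)[rule_format]] that sub by blast
  qed
  have empty: "\<forall>u v. consecutive T u v \<longrightarrow> g u v = {}" if fin: "finite (E // iso_rel C)"
  proof (rule ccontr)
    assume "\<not> ?thesis"
    then have "carrier A\<^sub>0 \<noteq> carrier (assoc_tconf C A\<^sub>0)"
      using T[OF \<open>A\<^sub>0 \<in> E\<close>] by blast
    moreover have "carrier (assoc_tconf C A\<^sub>0) \<subseteq> carrier A\<^sub>0"
      by (auto simp: carrier_assoc_tconf[OF A0] first_occurrences_def)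
    ultimately obtain z where "z \<in> carrier A\<^sub>0" "z \<notin> carrier (assoc_tconf C A\<^sub>0)"
      by blast
    then obtain c L U where "(c, L, U) \<in> point_type A\<^sub>0 ` carrier A\<^sub>0" "c \<in> L" "c \<in> U"
      using inner_point_type[OF A0] by blast
    then have "\<exists>B\<in>E. card (carrier B) = card (carrier A\<^sub>0) + n" for n
      using same_types_of_any_larger_size[OF A0] inE by meson
    then show False
      using infinite_iso_classes[OF sub] fin by blast
  qed
  have singleton: "is_singleton (E // iso_rel C)"
    if "\<forall>u v. consecutive T u v \<longrightarrow> g u v = {}"
  proof -
    have iso_T: "\<exists>f. clo_iso f T A" if "A \<in> E" for A
    proof -
      obtain f where "tconf_iso C f T (assoc_tconf C A)"
        and full: "carrier A = carrier (assoc_tconf C A)"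
        using T[OF \<open>A \<in> E\<close>] \<open>\<forall>u v. consecutive T u v \<longrightarrow> g u v = {}\<close> by blast
      then have "clo_iso f T (assoc_tconf C A)"
        by (simp add: tconf_iso_def)
      then have "clo_iso f T A"
        by (auto simp: clo_iso_def assoc_tconf_simps full[symmetric] bij_betw_def)
      then show ?thesis
        by blast
    qed
    have "iso_rel C `` {A} = iso_rel C `` {A\<^sub>0}" if "A \<in> E" for A
    proof (rule equiv_class_eq[OF equiv_iso_rel])
      obtain f f\<^sub>0 where f: "clo_iso f T A" and f0: "clo_iso f\<^sub>0 T A\<^sub>0"
        using iso_T[OF \<open>A \<in> E\<close>] iso_T[OF \<open>A\<^sub>0 \<in> E\<close>] by blast
      have "clo_iso (f\<^sub>0 \<circ> inv_into (carrier T) f) A A\<^sub>0"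
        by (rule clo_iso_comp[OF clo_iso_inv_into[OF f] f0])
      then show "(A, A\<^sub>0) \<in> iso_rel C"
        using that sub A0 by (auto simp: iso_rel_def)
    qed
    then have "(\<lambda>A. iso_rel C `` {A}) ` E = (\<lambda>_. iso_rel C `` {A\<^sub>0}) ` E"
      by (rule image_cong[OF refl])
    also have "(\<lambda>A. iso_rel C `` {A}) ` E = E // iso_rel C"
      by (auto simp: quotient_def)
    finally have "E // iso_rel C = {iso_rel C `` {A\<^sub>0}}"
      using \<open>A\<^sub>0 \<in> E\<close> by (auto simp: image_constant_conv)
    then show ?thesis
      by (simp add: is_singleton_def)
  qed
  have "finite (E // iso_rel C)" if "is_singleton (E // iso_rel C)"
    using that by (auto simp: is_singleton_def)
  with empty singleton show ?thesis
    by blast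
qed

end
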